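(* Let $k\geq 2$ and $n\geq 2k-3$ be integers. Let $P\in \mathbb{R}[x_1,\dots,x_n]$ be a polynomial having zeroes of multiplicity at least $k$ at all points in $\{0,1\}^n\setminus \{(0,\dots,0)\}$, and such that $P$ does not have a zero of multiplicity at least $k-1$ at $(0,\dots,0)$. Then $\deg P\geq n+2k-3$. Furthermore, for every $\ell\in\{0,\dots,k-2\}$, there exists a polynomial $P\in \mathbb{R}[x_1,\dots,x_n]$ with $\deg P= n+2k-3$ having zeroes of multiplicity at least $k$ at all points in $\{0,1\}^n\setminus \{(0,\dots,0)\}$, and having a zero of multiplicity exactly $\ell$ at $(0,\dots,0)$.
   Context: A polynomial $P\in \mathbb{R}[x_1,\dots,x_n]$ has a zero of multiplicity at least $k$ at a point $a\in \mathbb{R}^n$ if all partial derivatives of $P$ of order at most $k-1$ (including $P$ itself) vanish at $a$. It has a zero of multiplicity exactly $\ell$ at $a$ if it has a zero of multiplicity at least $\ell$ but not at least $\ell+1$ at $a$ (multiplicity exactly $0$ means $P(a)\neq 0$). *)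

theory Defs
  imports "HOL-Analysis.Analysis" "HOL-Library.Poly_Mapping"
begin

text \<open>
  A monomial is its finitely supported exponent vector, and a polynomial is the finitely supported
  family of its coefficients, so that addition and multiplication are those of \<^theory>\<open>HOL-Library.Poly_Mapping\<close>.
  The variables are indexed from 0, and \<open>polys n\<close> is the ring $R[x_0,\dots,x_{n-1}]$.
\<close>

type_synonym monomial = "nat \<Rightarrow>\<^sub>0 nat"
type_synonym mpoly = "monomial \<Rightarrow>\<^sub>0 real"

definition polys :: "nat \<Rightarrow> mpoly set" where
  "polys n = {P. \<forall>m\<in>Poly_Mapping.keys P. Poly_Mapping.keys m \<subseteq> {..<n}}"

definition monom_degree :: "monomial \<Rightarrow> nat" where
  "monom_degree m = (\<Sum>i\<in>Poly_Mapping.keys m. Poly_Mapping.lookup m i)"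

text \<open>The total degree; the zero polynomial is given degree 0.\<close>

definition total_degree :: "mpoly \<Rightarrow> nat" where
  "total_degree P = Max (insert 0 (monom_degree ` Poly_Mapping.keys P))"

definition monom_eval :: "(nat \<Rightarrow> real) \<Rightarrow> monomial \<Rightarrow> real" where
  "monom_eval a m = (\<Prod>i\<in>Poly_Mapping.keys m. a i ^ Poly_Mapping.lookup m i)"

definition mpoly_eval :: "mpoly \<Rightarrow> (nat \<Rightarrow> real) \<Rightarrow> real" where
  "mpoly_eval P a = (\<Sum>m\<in>Poly_Mapping.keys P. Poly_Mapping.lookup P m * monom_eval a m)"

text \<open>
  The monomial $m = x_i^e m'$ has derivative $e x_i^{e-1} m'$. The exponent vectors are subtracted
  with truncation, which only matters for $e = 0$, where the coefficient vanishes.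
\<close>

definition partial_deriv :: "nat \<Rightarrow> mpoly \<Rightarrow> mpoly" where
  "partial_deriv i P = (\<Sum>m\<in>Poly_Mapping.keys P.
     Poly_Mapping.single (m - Poly_Mapping.single i 1)
       (Poly_Mapping.lookup P m * real (Poly_Mapping.lookup m i)))"

text \<open>
  A list of variable indices stands for an iterated partial derivative whose order is the length
  of the list. Order at most \<open>k - 1\<close> is written \<open>length is < k\<close>, so that for \<open>k = 0\<close> there is
  no condition.
\<close>

definition zero_mult_at_least :: "nat \<Rightarrow> nat \<Rightarrow> mpoly \<Rightarrow> (nat \<Rightarrow> real) \<Rightarrow> bool" where
  "zero_mult_at_least n k P a \<longleftrightarrow>
     (\<forall>is. set is \<subseteq> {..<n} \<and> length is < k \<longrightarrow> mpoly_eval (fold partial_deriv is P) a = 0)"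

definition zero_mult_exactly :: "nat \<Rightarrow> nat \<Rightarrow> mpoly \<Rightarrow> (nat \<Rightarrow> real) \<Rightarrow> bool" where
  "zero_mult_exactly n l P a \<longleftrightarrow>
     zero_mult_at_least n l P a \<and> \<not> zero_mult_at_least n (Suc l) P a"

text \<open>
  Points of $R^n$ are functions that vanish at all indices from \<open>n\<close> on; in particular the origin
  is the zero function.
\<close>

definition origin :: "nat \<Rightarrow> real" where
  "origin = (\<lambda>_. 0)"

definition hypercube :: "nat \<Rightarrow> (nat \<Rightarrow> real) set" where
  "hypercube n = {a. (\<forall>i<n. a i \<in> {0, 1}) \<and> (\<forall>i\<ge>n. a i = 0)}"

lemma zero_mult_exactly_0: "zero_mult_exactly n 0 P a \<longleftrightarrow> mpoly_eval P a \<noteq> 0"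
  by (auto simp: zero_mult_exactly_def zero_mult_at_least_def)

lemma mpoly_eval_superset:
  assumes "finite S" "Poly_Mapping.keys P \<subseteq> S"
  shows "mpoly_eval P a = (\<Sum>m\<in>S. Poly_Mapping.lookup P m * monom_eval a m)"
  unfolding mpoly_eval_def using assms
  by (intro sum.mono_neutral_left) (auto simp: in_keys_iff)

lemma mpoly_eval_0 [simp]: "mpoly_eval 0 a = 0"
  by (simp add: mpoly_eval_def)

lemma mpoly_eval_add: "mpoly_eval (P + Q) a = mpoly_eval P a + mpoly_eval Q a"
  using mpoly_eval_superset[of "Poly_Mapping.keys P \<union> Poly_Mapping.keys Q" P a]
    mpoly_eval_superset[of "Poly_Mapping.keys P \<union> Poly_Mapping.keys Q" Q a]
    mpoly_eval_superset[of "Poly_Mapping.keys P \<union> Poly_Mapping.keys Q" "P + Q" a]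
    Poly_Mapping.keys_add[of P Q]
  by (simp add: lookup_add algebra_simps sum.distrib)

lemma mpoly_eval_single: "mpoly_eval (Poly_Mapping.single m c) a = c * monom_eval a m"
  by (simp add: mpoly_eval_def)

lemma mpoly_eval_sum: "mpoly_eval (sum f S) a = (\<Sum>x\<in>S. mpoly_eval (f x) a)"
  by (induction S rule: infinite_finite_induct) (auto simp: mpoly_eval_add)

lemma monom_eval_superset:
  assumes "finite S" "Poly_Mapping.keys m \<subseteq> S"
  shows "monom_eval a m = (\<Prod>i\<in>S. a i ^ Poly_Mapping.lookup m i)"
  unfolding monom_eval_def using assms
  by (intro prod.mono_neutral_left) (auto simp: in_keys_iff)

text \<open>The formal partial derivative is the analytic one.\<close>

lemma partial_deriv_has_field_derivative:
  "((\<lambda>t. mpoly_eval P (a(i := t))) has_field_derivative mpoly_eval (partial_deriv i P) a) (at (a i))"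
proof -
  have mono: "((\<lambda>t. monom_eval (a(i := t)) m) has_field_derivative
      real (Poly_Mapping.lookup m i) * monom_eval a (m - Poly_Mapping.single i 1)) (at (a i))" for m
  proof -
    let ?R = "Poly_Mapping.keys m - {i}"
    define c where "c = (\<Prod>j\<in>?R. a j ^ Poly_Mapping.lookup m j)"
    have split: "monom_eval b m' = b i ^ Poly_Mapping.lookup m' i * (\<Prod>j\<in>?R. b j ^ Poly_Mapping.lookup m' j)"
      if "Poly_Mapping.keys m' \<subseteq> insert i (Poly_Mapping.keys m)" for b m'
      using monom_eval_superset[OF _ that, of b]
        prod.remove[of "insert i (Poly_Mapping.keys m)" i "\<lambda>j. b j ^ Poly_Mapping.lookup m' j"]
      by simp
    have 1: "monom_eval (a(i := t)) m = t ^ Poly_Mapping.lookup m i * c" for t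
      by (subst split) (auto simp: c_def intro!: prod.cong)
    have sub: "Poly_Mapping.keys (m - Poly_Mapping.single i 1) \<subseteq> insert i (Poly_Mapping.keys m)"
      by (auto simp: in_keys_iff lookup_minus)
    have 2: "monom_eval a (m - Poly_Mapping.single i 1) = a i ^ (Poly_Mapping.lookup m i - 1) * c"
      by (subst split[OF sub]) (auto simp: c_def lookup_minus lookup_single when_def intro!: prod.cong)
    show ?thesis
      unfolding 1 2 by (auto intro!: derivative_eq_intros)
  qed
  have "((\<lambda>t. \<Sum>m\<in>Poly_Mapping.keys P. Poly_Mapping.lookup P m * monom_eval (a(i := t)) m)
      has_field_derivative (\<Sum>m\<in>Poly_Mapping.keys P. Poly_Mapping.lookup P m *
        (real (Poly_Mapping.lookup m i) * monom_eval a (m - Poly_Mapping.single i 1)))) (at (a i))"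
    by (intro DERIV_sum DERIV_cmult mono)
  then show ?thesis
    by (simp add: mpoly_eval_def[of P] partial_deriv_def mpoly_eval_sum mpoly_eval_single mult.assoc)
qed

end

theory Submission
  imports Defs
begin

text \<open>
  Lower bound. For real $u_i$, distinct and nonzero, the equation $x^2 - x = u_i t$ has two roots in
  $R[[t]]$, one with constant term 0 and one with constant term 1. Substituting one of them for each
  $x_i$ gives a curve through each vertex of the cube, and $P$ vanishes to order $k$ along all these
  curves except the one through the origin. In a suitably signed sum over all $2^n$ curves, a monomial
  contributes the product of the square roots $\sqrt{1 + 4 u_i t}$ with a polynomial in $t$ of at most
  half its degree. If $\deg P < n + 2k - 3$, this kills the coefficient of $t^{k-1}$ of the value $g$ of
  $P$ along the curve through the origin divided by these square roots, and, with a modified weight for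
  the variable $j$, also that of $g$ times the second root for $u_j$. These coefficients are the values
  at 0 and all $u_i$ of a polynomial of degree at most $k - 1$ whose coefficients are nonzero
  multiples of those of $g$. Hence $g$ has order at least $k$, and as $u$ is generic, $P$ has
  multiplicity at least $k - 1$ at the origin.

  Existence. Starting from $x_0^l \prod_i (x_i - 1)^k$, a monomial $x^m$ of degree at least $n + 2k - 2$
  is replaced by terms of lower degree modulo
  $\prod_i x_i^{\lfloor m_i/2\rfloor} (x_i - 1)^{\lceil m_i/2\rceil}$, which has multiplicity at least $k$
  at the other vertices and at least $k - 1$ at the origin.
\<close>

unbundle no vec_syntax
unbundle fps_syntax

subsection \<open>Derivatives and multiplicities\<close>

lemma mpoly_eq_sum_single: "P = (\<Sum>m\<in>Poly_Mapping.keys P. Poly_Mapping.single m (Poly_Mapping.lookup P m))"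
  for P :: mpoly
  by (rule poly_mapping_eqI)
    (auto simp: lookup_sum lookup_single when_def in_keys_iff sum.delta'[of "Poly_Mapping.keys P"])

lemma mpoly_induct [case_names single add]:
  fixes P :: mpoly
  assumes "\<And>m c. Q (Poly_Mapping.single m c)" and "\<And>P P'. Q P \<Longrightarrow> Q P' \<Longrightarrow> Q (P + P')"
  shows "Q P"
proof -
  have "Q (\<Sum>m\<in>S. Poly_Mapping.single m (f m))" if "finite S" for S and f :: "monomial \<Rightarrow> real"
    using that
  proof (induction S)
    case empty
    then show ?case using assms(1)[of 0 0] by simp
  qed (simp add: assms)
  from this[of "Poly_Mapping.keys P" "Poly_Mapping.lookup P"] show ?thesis
    using mpoly_eq_sum_single[of P] by simp
qed

text \<open>The definition sums over the keys of \<open>P\<close> and so is not visibly additive.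
  Read coefficientwise, the derivative is linear in \<open>P\<close>, and the truncated subtraction
  of exponents becomes an honest shift.\<close>

lemma lookup_partial_deriv:
  "Poly_Mapping.lookup (partial_deriv i P) m =
     real (Poly_Mapping.lookup m i + 1) * Poly_Mapping.lookup P (m + Poly_Mapping.single i 1)"
proof -
  let ?m' = "m + Poly_Mapping.single i 1"
  have "Poly_Mapping.lookup (Poly_Mapping.single (l - Poly_Mapping.single i 1)
          (Poly_Mapping.lookup P l * real (Poly_Mapping.lookup l i))) m =
        (if l = ?m' then Poly_Mapping.lookup P l * real (Poly_Mapping.lookup l i) else 0)" for l
  proof (cases "Poly_Mapping.lookup l i = 0")
    case True
    then show ?thesis by (auto simp: lookup_add)
  next
    case False
    have "(l - Poly_Mapping.single i 1) + Poly_Mapping.single i 1 = l"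
      using False by (intro poly_mapping_eqI) (auto simp: lookup_add lookup_minus lookup_single when_def)
    then have "l - Poly_Mapping.single i 1 = m \<longleftrightarrow> l = ?m'"
      by (metis add_diff_cancel_right')
    then show ?thesis by (auto simp: lookup_single when_def)
  qed
  then have "Poly_Mapping.lookup (partial_deriv i P) m =
      (\<Sum>l\<in>Poly_Mapping.keys P. if l = ?m' then Poly_Mapping.lookup P l * real (Poly_Mapping.lookup l i) else 0)"
    by (simp add: partial_deriv_def lookup_sum)
  also have "\<dots> = real (Poly_Mapping.lookup m i + 1) * Poly_Mapping.lookup P ?m'"
    by (auto simp: in_keys_iff lookup_add)
  finally show ?thesis .
qed

lemma partial_deriv_add: "partial_deriv i (P + Q) = partial_deriv i P + partial_deriv i Q"
  by (rule poly_mapping_eqI) (simp add: lookup_partial_deriv lookup_add algebra_simps)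

lemma partial_deriv_single:
  "partial_deriv i (Poly_Mapping.single m c) =
     Poly_Mapping.single (m - Poly_Mapping.single i 1) (c * real (Poly_Mapping.lookup m i))"
  by (cases "c = 0") (auto simp: partial_deriv_def)

lemma partial_deriv_mult:
  "partial_deriv i (P * Q) = partial_deriv i P * Q + P * partial_deriv i Q"
proof (induction P rule: mpoly_induct)
  case (add P P')
  then show ?case by (simp add: partial_deriv_add algebra_simps)
next
  case (single m c)
  show ?case
  proof (induction Q rule: mpoly_induct)
    case (add Q Q')
    then show ?case by (simp add: partial_deriv_add algebra_simps)
  next
    case (single l d)
    let ?e = "Poly_Mapping.single i (1::nat)"
    \<comment> \<open>Truncated subtraction passes to the summand \<open>a\<close> only if
      \<open>i\<close> occurs in it; otherwise the coefficient
      \<open>Poly_Mapping.lookup a i\<close> is 0 and both terms below vanish.\<close>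
    have shift: "a + b - ?e = (a - ?e) + b" if "Poly_Mapping.lookup a i \<noteq> 0" for a b :: monomial
      using that
      by (intro poly_mapping_eqI) (auto simp: lookup_add lookup_minus lookup_single when_def)
    have "Poly_Mapping.single (m + l - ?e) (c * d * real (Poly_Mapping.lookup m i)) =
          Poly_Mapping.single ((m - ?e) + l) (c * real (Poly_Mapping.lookup m i) * d)"
      using shift[of m l] by (cases "Poly_Mapping.lookup m i = 0") (auto simp: mult_ac)
    moreover have "Poly_Mapping.single (m + l - ?e) (c * d * real (Poly_Mapping.lookup l i)) =
          Poly_Mapping.single (m + (l - ?e)) (c * (d * real (Poly_Mapping.lookup l i)))"
      using shift[of l m] by (cases "Poly_Mapping.lookup l i = 0") (auto simp: mult_ac add_ac)
    ultimately show ?case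
      by (simp add: partial_deriv_single mult_single lookup_add distrib_left single_add)
  qed
qed

lemma partial_deriv_polys: "P \<in> polys n \<Longrightarrow> partial_deriv i P \<in> polys n"
proof -
  assume P: "P \<in> polys n"
  have "Poly_Mapping.keys m \<subseteq> {..<n}" if "m \<in> Poly_Mapping.keys (partial_deriv i P)" for m
  proof -
    from that have "m + Poly_Mapping.single i 1 \<in> Poly_Mapping.keys P"
      by (auto simp: in_keys_iff lookup_partial_deriv)
    with P have "Poly_Mapping.keys (m + Poly_Mapping.single i 1) \<subseteq> {..<n}"
      by (auto simp: polys_def)
    moreover have "Poly_Mapping.keys m \<subseteq> Poly_Mapping.keys (m + Poly_Mapping.single i 1)"
      by (auto simp: in_keys_iff lookup_add)
    ultimately show ?thesis by blast
  qed
  then show ?thesis by (auto simp: polys_def)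
qed

lemma zero_mult_0: "zero_mult_at_least n 0 P a"
  by (simp add: zero_mult_at_least_def)

text \<open>\<open>fold\<close> applies the head of the list first, so splitting off the head leaves
  the same condition on a first partial derivative. This recursion drives the later inductions on
  multiplicity.\<close>

lemma zero_mult_Suc:
  "zero_mult_at_least n (Suc k) P a \<longleftrightarrow>
     mpoly_eval P a = 0 \<and> (\<forall>i<n. zero_mult_at_least n k (partial_deriv i P) a)"
proof
  assume L: "zero_mult_at_least n (Suc k) P a"
  have "mpoly_eval P a = 0"
    using L[unfolded zero_mult_at_least_def, rule_format, of "[]"] by simp
  moreover have "zero_mult_at_least n k (partial_deriv i P) a" if "i < n" for i
    unfolding zero_mult_at_least_def
  proof (intro allI impI)
    fix js assume "set js \<subseteq> {..<n} \<and> length js < k"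
    then show "mpoly_eval (fold partial_deriv js (partial_deriv i P)) a = 0"
      using L[unfolded zero_mult_at_least_def, rule_format, of "i # js"] that by simp
  qed
  ultimately show "mpoly_eval P a = 0 \<and> (\<forall>i<n. zero_mult_at_least n k (partial_deriv i P) a)"
    by blast
next
  assume R: "mpoly_eval P a = 0 \<and> (\<forall>i<n. zero_mult_at_least n k (partial_deriv i P) a)"
  show "zero_mult_at_least n (Suc k) P a"
    unfolding zero_mult_at_least_def
  proof (intro allI impI)
    fix js assume js: "set js \<subseteq> {..<n} \<and> length js < Suc k"
    show "mpoly_eval (fold partial_deriv js P) a = 0"
    proof (cases js)
      case Nil
      with R show ?thesis by simp
    next
      case (Cons i js')
      with R js show ?thesis by (auto simp: zero_mult_at_least_def)
    qed
  qed
qed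

lemma zero_mult_mono: "zero_mult_at_least n k P a \<Longrightarrow> l \<le> k \<Longrightarrow> zero_mult_at_least n l P a"
  by (auto simp: zero_mult_at_least_def)

lemma zero_mult_add:
  "zero_mult_at_least n k P a \<Longrightarrow> zero_mult_at_least n k Q a \<Longrightarrow> zero_mult_at_least n k (P + Q) a"
  by (induction k arbitrary: P Q) (auto simp: zero_mult_0 zero_mult_Suc mpoly_eval_add partial_deriv_add)

lemma monom_eval_add: "monom_eval a (m + l) = monom_eval a m * monom_eval a l"
  by (simp add: monom_eval_superset[of "Poly_Mapping.keys m \<union> Poly_Mapping.keys l" m]
      monom_eval_superset[of "Poly_Mapping.keys m \<union> Poly_Mapping.keys l" l]
      monom_eval_superset[of "Poly_Mapping.keys m \<union> Poly_Mapping.keys l" "m + l"]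
      keys_add lookup_add power_add prod.distrib)

lemma mpoly_eval_mult: "mpoly_eval (P * Q) a = mpoly_eval P a * mpoly_eval Q a"
proof (induction P rule: mpoly_induct)
  case (add P P')
  then show ?case by (simp add: mpoly_eval_add algebra_simps)
next
  case (single m c)
  show ?case
    by (induction Q rule: mpoly_induct)
      (auto simp: mpoly_eval_add mpoly_eval_single mult_single monom_eval_add algebra_simps)
qed

text \<open>Induction on the total order \<open>k + l\<close>: each summand of the product rule
  differentiates only one factor and so loses at most one order.\<close>

lemma zero_mult_mult:
  assumes "zero_mult_at_least n k P a" "zero_mult_at_least n l Q a"
  shows "zero_mult_at_least n (k + l) (P * Q) a"
  using assms
proof (induction "k + l" arbitrary: k l P Q)
  case 0
  then show ?case by (simp add: zero_mult_0)
next
  case (Suc N)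
  have "mpoly_eval (P * Q) a = 0"
  proof (cases k)
    case 0
    then obtain l' where "l = Suc l'" using Suc.hyps(2) by (cases l) auto
    then show ?thesis using Suc.prems(2) by (simp add: zero_mult_Suc mpoly_eval_mult)
  qed (use Suc.prems(1) in \<open>simp add: zero_mult_Suc mpoly_eval_mult\<close>)
  moreover have "zero_mult_at_least n N (partial_deriv i (P * Q)) a" if "i < n" for i
  proof -
    \<comment> \<open>For \<open>k = 0\<close> the first factor has no order to lose, and the whole
      order \<open>N\<close> comes from \<open>Q\<close>.\<close>
    have "zero_mult_at_least n N (partial_deriv i P * Q) a"
    proof (cases k)
      case 0
      with Suc.hyps(2) have l: "l = Suc N" by simp
      have "zero_mult_at_least n N Q a"
        using zero_mult_mono[OF Suc.prems(2), of N] l by simp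
      with Suc.hyps(1)[of 0 N "partial_deriv i P" Q] show ?thesis
        by (simp add: zero_mult_0)
    next
      case (Suc k')
      with Suc.hyps(1)[of k' l "partial_deriv i P" Q] Suc.hyps(2) Suc.prems that show ?thesis
        by (auto simp: zero_mult_Suc)
    qed
    moreover have "zero_mult_at_least n N (P * partial_deriv i Q) a"
    proof (cases l)
      case 0
      with Suc.hyps(2) have k: "k = Suc N" by simp
      have "zero_mult_at_least n N P a"
        using zero_mult_mono[OF Suc.prems(1), of N] k by simp
      with Suc.hyps(1)[of N 0 P "partial_deriv i Q"] show ?thesis
        by (simp add: zero_mult_0)
    next
      case (Suc l')
      with Suc.hyps(1)[of k l' P "partial_deriv i Q"] Suc.hyps(2) Suc.prems that show ?thesis
        by (auto simp: zero_mult_Suc)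
    qed
    ultimately show ?thesis by (simp add: partial_deriv_mult zero_mult_add)
  qed
  ultimately show ?case
    unfolding Suc.hyps(2)[symmetric] zero_mult_Suc by blast
qed

subsection \<open>Substitution of power series\<close>

definition monom_feval :: "(nat \<Rightarrow> real fps) \<Rightarrow> monomial \<Rightarrow> real fps" where
  "monom_feval X m = (\<Prod>i\<in>Poly_Mapping.keys m. X i ^ Poly_Mapping.lookup m i)"

definition mpoly_feval :: "(nat \<Rightarrow> real fps) \<Rightarrow> mpoly \<Rightarrow> real fps" where
  "mpoly_feval X P = (\<Sum>m\<in>Poly_Mapping.keys P. fps_const (Poly_Mapping.lookup P m) * monom_feval X m)"

lemma monom_feval_superset:
  assumes "finite S" "Poly_Mapping.keys m \<subseteq> S"
  shows "monom_feval X m = (\<Prod>i\<in>S. X i ^ Poly_Mapping.lookup m i)"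
  unfolding monom_feval_def using assms
  by (intro prod.mono_neutral_left) (auto simp: in_keys_iff)

lemma mpoly_feval_superset:
  assumes "finite S" "Poly_Mapping.keys P \<subseteq> S"
  shows "mpoly_feval X P = (\<Sum>m\<in>S. fps_const (Poly_Mapping.lookup P m) * monom_feval X m)"
  unfolding mpoly_feval_def using assms
  by (intro sum.mono_neutral_left) (auto simp: in_keys_iff)

lemma mpoly_feval_add: "mpoly_feval X (P + Q) = mpoly_feval X P + mpoly_feval X Q"
  by (simp add: mpoly_feval_superset[of "Poly_Mapping.keys P \<union> Poly_Mapping.keys Q" P]
      mpoly_feval_superset[of "Poly_Mapping.keys P \<union> Poly_Mapping.keys Q" Q]
      mpoly_feval_superset[of "Poly_Mapping.keys P \<union> Poly_Mapping.keys Q" "P + Q"]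
      Poly_Mapping.keys_add lookup_add sum.distrib distrib_right flip: fps_const_add)

lemma mpoly_feval_single: "mpoly_feval X (Poly_Mapping.single m c) = fps_const c * monom_feval X m"
  by (simp add: mpoly_feval_def)

lemma mpoly_feval_sum: "mpoly_feval X (sum f S) = (\<Sum>x\<in>S. mpoly_feval X (f x))"
  by (induction S rule: infinite_finite_induct) (auto simp: mpoly_feval_add mpoly_feval_def[of X 0])

lemma monom_feval_add: "monom_feval X (m + l) = monom_feval X m * monom_feval X l"
  by (simp add: monom_feval_superset[of "Poly_Mapping.keys m \<union> Poly_Mapping.keys l" m]
      monom_feval_superset[of "Poly_Mapping.keys m \<union> Poly_Mapping.keys l" l]
      monom_feval_superset[of "Poly_Mapping.keys m \<union> Poly_Mapping.keys l" "m + l"]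
      Poly_Mapping.keys_add lookup_add power_add prod.distrib)

lemma mpoly_feval_mult: "mpoly_feval X (P * Q) = mpoly_feval X P * mpoly_feval X Q"
proof (induction P rule: mpoly_induct)
  case (add P P')
  then show ?case by (simp add: mpoly_feval_add algebra_simps)
next
  case (single m c)
  show ?case
    by (induction Q rule: mpoly_induct)
      (auto simp: mpoly_feval_add mpoly_feval_single mult_single monom_feval_add algebra_simps
        simp flip: fps_const_mult)
qed

lemma fps_deriv_prod:
  fixes f :: "'b \<Rightarrow> 'a :: comm_ring_1 fps"
  assumes "finite S"
  shows "fps_deriv (\<Prod>i\<in>S. f i) = (\<Sum>i\<in>S. fps_deriv (f i) * (\<Prod>j\<in>S - {i}. f j))"
  using assms
proof (induction S)
  case (insert x S)
  have "(\<Prod>j\<in>insert x S - {i}. f j) = f x * (\<Prod>j\<in>S - {i}. f j)" if "i \<in> S" for i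
  proof -
    have "insert x S - {i} = insert x (S - {i})" using insert.hyps that by auto
    then show ?thesis using insert.hyps by simp
  qed
  moreover have "insert x S - {x} = S" using insert.hyps by auto
  ultimately show ?case
    using insert by (simp add: sum_distrib_left mult_ac)
qed simp

lemma fps_deriv_monom_feval:
  assumes "finite S" "Poly_Mapping.keys m \<subseteq> S"
  shows "fps_deriv (monom_feval X m) =
    (\<Sum>i\<in>S. of_nat (Poly_Mapping.lookup m i) * monom_feval X (m - Poly_Mapping.single i 1) * fps_deriv (X i))"
proof -
  have "fps_deriv (X i ^ Poly_Mapping.lookup m i) * (\<Prod>j\<in>S - {i}. X j ^ Poly_Mapping.lookup m j) =
     of_nat (Poly_Mapping.lookup m i) * monom_feval X (m - Poly_Mapping.single i 1) * fps_deriv (X i)"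
    if "i \<in> S" for i
  proof -
    have "Poly_Mapping.keys (m - Poly_Mapping.single i 1) \<subseteq> S"
      using assms(2) by (auto simp: in_keys_iff lookup_minus)
    then have "monom_feval X (m - Poly_Mapping.single i 1) =
        (\<Prod>j\<in>S. X j ^ Poly_Mapping.lookup (m - Poly_Mapping.single i 1) j)"
      using assms(1) by (intro monom_feval_superset)
    also have "\<dots> = X i ^ (Poly_Mapping.lookup m i - 1) * (\<Prod>j\<in>S - {i}. X j ^ Poly_Mapping.lookup m j)"
      using assms(1) that
      by (subst prod.remove[of S i]) (auto simp: lookup_minus lookup_single when_def intro!: prod.cong)
    finally show ?thesis by (simp add: fps_deriv_power' mult_ac)
  qed
  then show ?thesis
    using assms by (simp add: monom_feval_superset[of S m] fps_deriv_prod cong: sum.cong)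
qed

text \<open>The chain rule along the formal curve \<open>X\<close>. It translates conditions on
  partial derivatives into conditions on a single power series.\<close>

lemma fps_deriv_mpoly_feval:
  assumes "P \<in> polys n"
  shows "fps_deriv (mpoly_feval X P) = (\<Sum>i<n. mpoly_feval X (partial_deriv i P) * fps_deriv (X i))"
proof -
  have "fps_deriv (mpoly_feval X P) = (\<Sum>m\<in>Poly_Mapping.keys P. fps_const (Poly_Mapping.lookup P m) *
      (\<Sum>i<n. of_nat (Poly_Mapping.lookup m i) * monom_feval X (m - Poly_Mapping.single i 1) * fps_deriv (X i)))"
    using assms by (auto simp: mpoly_feval_def polys_def fps_deriv_sum fps_deriv_monom_feval[of "{..<n}"] intro!: sum.cong)
  also have "\<dots> = (\<Sum>i<n. \<Sum>m\<in>Poly_Mapping.keys P. fps_const (Poly_Mapping.lookup P m) *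
      (of_nat (Poly_Mapping.lookup m i) * monom_feval X (m - Poly_Mapping.single i 1) * fps_deriv (X i)))"
    unfolding sum_distrib_left by (rule sum.swap)
  also have "\<dots> = (\<Sum>i<n. mpoly_feval X (partial_deriv i P) * fps_deriv (X i))"
    by (simp add: partial_deriv_def mpoly_feval_sum mpoly_feval_single sum_distrib_left mult_ac
        fps_of_nat flip: fps_const_mult)
  finally show ?thesis .
qed

lemma mpoly_feval_nth_0: "mpoly_feval X P $ 0 = mpoly_eval P (\<lambda>i. X i $ 0)"
proof -
  have "(\<Prod>i\<in>S. F i) $ 0 = (\<Prod>i\<in>S. F i $ 0)" for F :: "nat \<Rightarrow> real fps" and S
    by (induction S rule: infinite_finite_induct) auto
  then show ?thesis
    by (simp add: mpoly_feval_def monom_feval_def mpoly_eval_def monom_eval_def fps_sum_nth fps_power_zeroth)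
qed

lemma fps_mult_nth_eq_0:
  fixes F :: "'a :: semiring_0 fps"
  assumes "\<forall>d<k. F $ d = 0" "d < k"
  shows "(F * G) $ d = 0"
  using assms by (auto simp: fps_mult_nth intro!: sum.neutral)

text \<open>By the chain rule, the derivative of \<open>P\<close> along a curve through the point is
  a combination of partial derivatives, whose multiplicity is one less. Over the reals, the
  coefficients of the derivative determine all coefficients except the constant one, which is the
  value at the point.\<close>

lemma zero_mult_feval:
  assumes "zero_mult_at_least n k P (\<lambda>i. X i $ 0)" "P \<in> polys n"
  shows "\<forall>d<k. mpoly_feval X P $ d = 0"
  using assms
proof (induction k arbitrary: P)
  case (Suc k)
  have "fps_deriv (mpoly_feval X P) $ d = 0" if "d < k" for d
    using Suc.IH[of "partial_deriv _ P"] Suc.prems that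
    by (auto simp: fps_deriv_mpoly_feval fps_sum_nth zero_mult_Suc partial_deriv_polys
        intro!: sum.neutral fps_mult_nth_eq_0[of k])
  then have "mpoly_feval X P $ Suc d = 0" if "d < k" for d
    using that by simp
  moreover have "mpoly_feval X P $ 0 = 0"
    using Suc.prems by (simp add: mpoly_feval_nth_0 zero_mult_Suc)
  ultimately show ?case
    by (metis less_Suc_eq_0_disj)
qed simp

subsection \<open>Weighted sums over the cube\<close>

text \<open>The binomial series for the square root of 1 + 4ut, which is the discriminant of x^2 - x
  - ut.\<close>

definition fps_root :: "real \<Rightarrow> real fps" where
  "fps_root u = fps_binomial (1 / 2) oo (fps_const (4 * u) * fps_X)"

text \<open>\<open>hi u\<close> and \<open>lo u\<close> are the roots of x^2 - x = ut given by the
  quadratic formula; their constant terms are 1 and 0.\<close>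

definition hi :: "real \<Rightarrow> real fps" where
  "hi u = fps_const (1 / 2) * (1 + fps_root u)"

definition lo :: "real \<Rightarrow> real fps" where
  "lo u = fps_const (1 / 2) * (1 - fps_root u)"

lemma fps_root_nth: "fps_root u $ i = ((1 / 2) gchoose i) * (4 * u) ^ i"
  by (simp add: fps_root_def fps_compose_linear)

lemma fps_root_sq: "fps_root u * fps_root u = 1 + fps_const (4 * u) * fps_X"
proof -
  have "fps_root u * fps_root u = (1 + fps_X) oo (fps_const (4 * u) * fps_X)"
    unfolding fps_root_def
    by (simp add: fps_compose_mult_distrib[symmetric] fps_binomial_add_mult[symmetric] fps_binomial_1)
  then show ?thesis by (simp add: fps_compose_add_distrib)
qed

lemma half_half: "fps_const (1 / 2 :: real) + fps_const (1 / 2) = 1"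
  by (simp flip: fps_const_1_eq_1)

lemma hi_plus_lo: "hi u + lo u = 1"
proof -
  have "hi u + lo u = fps_const (1 / 2) + fps_const (1 / 2)"
    by (simp add: hi_def lo_def algebra_simps)
  then show ?thesis by (simp add: half_half)
qed

lemma hi_minus_lo: "hi u - lo u = fps_root u"
proof -
  have "hi u - lo u = (fps_const (1 / 2) + fps_const (1 / 2)) * fps_root u"
    by (simp add: hi_def lo_def algebra_simps)
  then show ?thesis by (simp add: half_half)
qed

lemma hi_times_lo: "hi u * lo u = - fps_const u * fps_X"
proof -
  have "hi u * lo u = (fps_const (1 / 2) * fps_const (1 / 2)) * ((1 + fps_root u) * (1 - fps_root u))"
    by (simp only: hi_def lo_def mult_ac)
  also have "(1 + fps_root u) * (1 - fps_root u) = 1 - fps_root u * fps_root u"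
    by (simp add: algebra_simps)
  also have "fps_const (1 / 2) * fps_const (1 / 2) * \<dots> = - fps_const u * fps_X"
    by (simp add: fps_root_sq flip: mult.assoc)
  finally show ?thesis .
qed

lemma hi_sq: "hi u * hi u = hi u + fps_const u * fps_X"
proof -
  have "hi u * hi u = hi u * (hi u + lo u) - hi u * lo u" by (simp add: algebra_simps)
  then show ?thesis by (simp add: hi_plus_lo hi_times_lo)
qed

lemma lo_sq: "lo u * lo u = lo u + fps_const u * fps_X"
proof -
  have "lo u * lo u = lo u * (hi u + lo u) - hi u * lo u" by (simp add: algebra_simps)
  then show ?thesis by (simp add: hi_plus_lo hi_times_lo)
qed

text \<open>The Lucas sequences of the quadratic with roots \<^term>\<open>lo u\<close> and \<^term>\<open>hi u\<close>.\<close>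

fun lucas :: "real fps \<Rightarrow> real fps \<Rightarrow> real \<Rightarrow> nat \<Rightarrow> real fps" where
  "lucas c0 c1 u 0 = c0"
| "lucas c0 c1 u (Suc 0) = c1"
| "lucas c0 c1 u (Suc (Suc e)) = lucas c0 c1 u (Suc e) + fps_const u * fps_X * lucas c0 c1 u e"

text \<open>Powers of either root satisfy the recurrence of \<open>lucas\<close>, so agreement for
  exponents 0 and 1 propagates. In the applications \<open>s\<close> is the square root
  \<open>fps_root u\<close>, and the weights are chosen so that it factors out.\<close>

lemma lucas_closed_form:
  assumes "\<alpha> + \<beta> = s * c0" "\<alpha> * hi u + \<beta> * lo u = s * c1"
  shows "\<alpha> * hi u ^ e + \<beta> * lo u ^ e = s * lucas c0 c1 u e"
proof (induction e rule: induct_nat_012)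
  case (ge2 e)
  have "hi u ^ Suc (Suc e) = hi u ^ Suc e + fps_const u * fps_X * hi u ^ e"
    using hi_sq[of u] by (metis distrib_right mult.assoc power_Suc)
  moreover have "lo u ^ Suc (Suc e) = lo u ^ Suc e + fps_const u * fps_X * lo u ^ e"
    using lo_sq[of u] by (metis distrib_right mult.assoc power_Suc)
  ultimately have "\<alpha> * hi u ^ Suc (Suc e) + \<beta> * lo u ^ Suc (Suc e) =
      (\<alpha> * hi u ^ Suc e + \<beta> * lo u ^ Suc e) + fps_const u * fps_X * (\<alpha> * hi u ^ e + \<beta> * lo u ^ e)"
    by (simp only: algebra_simps)
  then show ?case
    by (simp only: ge2 lucas.simps algebra_simps)
qed (use assms in simp_all)

text \<open>Equivalently, the series is a polynomial of degree at most \<open>(e - r) / 2\<close>, and zero if \<open>e < r\<close>.\<close>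

definition half_bounded :: "nat \<Rightarrow> nat \<Rightarrow> real fps \<Rightarrow> bool" where
  "half_bounded r e F \<longleftrightarrow> (\<forall>i. e < 2 * i + r \<longrightarrow> F $ i = 0)"

lemma half_bounded_mult:
  assumes "half_bounded r e F" "half_bounded r' e' G"
  shows "half_bounded (r + r') (e + e') (F * G)"
  unfolding half_bounded_def
proof (intro allI impI)
  fix l assume l: "e + e' < 2 * l + (r + r')"
  have "F $ i * G $ (l - i) = 0" if "i \<le> l" for i
  proof (cases "e < 2 * i + r")
    case True
    with assms(1) show ?thesis by (simp add: half_bounded_def)
  next
    case False
    with l that have "e' < 2 * (l - i) + r'" by linarith
    with assms(2) show ?thesis by (simp add: half_bounded_def)
  qed
  then show "(F * G) $ l = 0" by (auto simp: fps_mult_nth intro!: sum.neutral)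
qed

lemma half_bounded_prod:
  assumes "finite S" "\<And>i. i \<in> S \<Longrightarrow> half_bounded (r i) (e i) (F i)"
  shows "half_bounded (sum r S) (sum e S) (prod F S)"
  using assms by (induction S) (auto intro: half_bounded_mult simp: half_bounded_def[of 0 0 1])

text \<open>In the recurrence, a factor t accompanies an increase of the index by 2, which is the
  rate that \<open>half_bounded\<close> allows.\<close>

lemma half_bounded_lucas:
  assumes "half_bounded r 0 c0" "half_bounded r 1 c1"
  shows "half_bounded r e (lucas c0 c1 u e)"
proof (induction e rule: induct_nat_012)
  case (ge2 e)
  have "(fps_X * lucas c0 c1 u e) $ i = 0" if "Suc (Suc e) < 2 * i + r" for i
    using that ge2(1) by (cases i) (auto simp: half_bounded_def)
  with ge2(2) show ?case by (auto simp: half_bounded_def mult.assoc)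
qed (use assms in simp_all)

text \<open>
  Weighting the \<open>2^n\<close> substitutions multiplicatively splits the sum over the cube into a product
  over the variables, for each monomial separately.
\<close>

lemma weighted_cube_sum:
  assumes P: "P \<in> polys n" and X: "\<And>A i. X A i = (if i \<in> A then hi (u i) else lo (u i))"
  shows "(\<Sum>A\<in>Pow {..<n}. (\<Prod>i\<in>A. \<alpha> i) * (\<Prod>i\<in>{..<n} - A. \<beta> i) * mpoly_feval (X A) P) =
    (\<Sum>m\<in>Poly_Mapping.keys P. fps_const (Poly_Mapping.lookup P m) *
      (\<Prod>i<n. \<alpha> i * hi (u i) ^ Poly_Mapping.lookup m i + \<beta> i * lo (u i) ^ Poly_Mapping.lookup m i))"
    (is "?L = _")
proof -
  have mono: "(\<Sum>A\<in>Pow {..<n}. (\<Prod>i\<in>A. \<alpha> i) * (\<Prod>i\<in>{..<n} - A. \<beta> i) * monom_feval (X A) m) =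
     (\<Prod>i<n. \<alpha> i * hi (u i) ^ Poly_Mapping.lookup m i + \<beta> i * lo (u i) ^ Poly_Mapping.lookup m i)"
    if m: "m \<in> Poly_Mapping.keys P" for m
  proof -
    have keys: "Poly_Mapping.keys m \<subseteq> {..<n}" using P m by (auto simp: polys_def)
    have "monom_feval (X A) m = (\<Prod>i\<in>A. hi (u i) ^ Poly_Mapping.lookup m i) *
        (\<Prod>i\<in>{..<n} - A. lo (u i) ^ Poly_Mapping.lookup m i)" if "A \<subseteq> {..<n}" for A
    proof -
      have "monom_feval (X A) m = (\<Prod>i\<in>A. X A i ^ Poly_Mapping.lookup m i) *
          (\<Prod>i\<in>{..<n} - A. X A i ^ Poly_Mapping.lookup m i)"
        using monom_feval_superset[OF _ keys, of "X A"] prod.subset_diff[OF that, of "\<lambda>i. X A i ^ Poly_Mapping.lookup m i"]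
        by (simp add: mult.commute)
      then show ?thesis by (simp add: X)
    qed
    then show ?thesis
      by (subst prod_add) (auto simp: prod.distrib mult_ac intro!: sum.cong)
  qed
  have "?L = (\<Sum>m\<in>Poly_Mapping.keys P. \<Sum>A\<in>Pow {..<n}. fps_const (Poly_Mapping.lookup P m) *
      ((\<Prod>i\<in>A. \<alpha> i) * (\<Prod>i\<in>{..<n} - A. \<beta> i) * monom_feval (X A) m))"
    unfolding mpoly_feval_def sum_distrib_left
    by (subst sum.swap) (simp add: mult_ac)
  also have "\<dots> = (\<Sum>m\<in>Poly_Mapping.keys P. fps_const (Poly_Mapping.lookup P m) *
      (\<Prod>i<n. \<alpha> i * hi (u i) ^ Poly_Mapping.lookup m i + \<beta> i * lo (u i) ^ Poly_Mapping.lookup m i))"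
    by (simp add: mono cong: sum.cong flip: sum_distrib_left)
  finally show ?thesis .
qed

lemma lo_nth_0: "lo u $ 0 = 0" and hi_nth_0: "hi u $ 0 = 1"
  by (simp_all add: lo_def hi_def fps_root_nth)

text \<open>The empty set indexes the curve through the origin, and all other terms of the cube sum
  vanish to order \<open>k\<close>. The total is the product of the square roots times a series
  without a term of degree \<open>k - 1\<close>. Dividing by that product, which is invertible,
  isolates the term of the empty set.\<close>

lemma weighted_coeff_eq_0:
  assumes P: "P \<in> polys n" and mult: "\<forall>a\<in>hypercube n - {origin}. zero_mult_at_least n k P a"
    and k: "k > 0"
    and ab: "\<And>i e. i < n \<Longrightarrow> \<alpha> i * hi (u i) ^ e + \<beta> i * lo (u i) ^ e = fps_root (u i) * Z i e"
    and Z: "\<And>i e. i < n \<Longrightarrow> half_bounded (r i) e (Z i e)"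
    and deg: "\<And>m. m \<in> Poly_Mapping.keys P \<Longrightarrow> monom_degree m < 2 * (k - 1) + sum r {..<n}"
  shows "((\<Prod>i<n. \<beta> i) * (mpoly_feval (\<lambda>i. lo (u i)) P * inverse (\<Prod>i<n. fps_root (u i)))) $ (k - 1) = 0"
proof -
  define X where "X A i = (if i \<in> A then hi (u i) else lo (u i))" for A i
  define W where "W A = (\<Prod>i\<in>A. \<alpha> i) * (\<Prod>i\<in>{..<n} - A. \<beta> i) * mpoly_feval (X A) P" for A
  define R where "R = (\<Sum>m\<in>Poly_Mapping.keys P. fps_const (Poly_Mapping.lookup P m) * (\<Prod>i<n. Z i (Poly_Mapping.lookup m i)))"
  define S where "S = (\<Prod>i<n. fps_root (u i))"
  have "S $ 0 = (\<Prod>i<n. fps_root (u i) $ 0)"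
    unfolding S_def by (induction n) auto
  then have S0: "S $ 0 \<noteq> 0" by (simp add: fps_root_nth)
  have "(\<Prod>i<n. \<alpha> i * hi (u i) ^ e i + \<beta> i * lo (u i) ^ e i) = S * (\<Prod>i<n. Z i (e i))" for e
    by (simp add: S_def ab flip: prod.distrib)
  then have "(\<Sum>A\<in>Pow {..<n}. W A) = S * R"
    unfolding W_def weighted_cube_sum[OF P X_def] R_def sum_distrib_left
    by (simp add: mult_ac)
  also have "(\<Sum>A\<in>Pow {..<n}. W A) = W {} + (\<Sum>A\<in>Pow {..<n} - {{}}. W A)"
    by (rule sum.remove) auto
  finally have W0: "W {} = S * R - (\<Sum>A\<in>Pow {..<n} - {{}}. W A)"
    by (simp add: algebra_simps)
  have "W A $ d = 0" if A: "A \<in> Pow {..<n} - {{}}" and d: "d < k" for A d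
  proof -
    \<comment> \<open>The curve \<open>X A\<close> starts at the indicator vector of
      \<open>A\<close>, a vertex other than the origin since \<open>A\<close> is nonempty.\<close>
    have eq: "(\<lambda>i. X A i $ 0) = (\<lambda>i. if i \<in> A then 1 else 0)"
      by (auto simp: X_def hi_nth_0 lo_nth_0)
    have "(\<lambda>i. if i \<in> A then 1 else 0) \<in> hypercube n - {origin}"
      using A by (auto simp: hypercube_def origin_def fun_eq_iff)
    with mult have low: "\<forall>d<k. mpoly_feval (X A) P $ d = 0"
      by (intro zero_mult_feval) (use P in \<open>auto simp: eq\<close>)
    show ?thesis
      unfolding W_def by (subst mult.commute) (rule fps_mult_nth_eq_0[OF low d])
  qed
  then have rest: "((\<Sum>A\<in>Pow {..<n} - {{}}. W A) * inverse S) $ (k - 1) = 0"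
    using k by (intro fps_mult_nth_eq_0[of k]) (auto simp: fps_sum_nth)
  \<comment> \<open>The hypothesis on degrees is exactly the condition of
    \<open>half_bounded\<close> at the index \<open>k - 1\<close>.\<close>
  have "(\<Prod>i<n. Z i (Poly_Mapping.lookup m i)) $ (k - 1) = 0" if "m \<in> Poly_Mapping.keys P" for m
  proof -
    have "Poly_Mapping.keys m \<subseteq> {..<n}" using P that by (auto simp: polys_def)
    then have "monom_degree m = (\<Sum>i<n. Poly_Mapping.lookup m i)"
      unfolding monom_degree_def by (intro sum.mono_neutral_left) (auto simp: in_keys_iff)
    with half_bounded_prod[of "{..<n}" r "Poly_Mapping.lookup m" "\<lambda>i. Z i (Poly_Mapping.lookup m i)"]
      Z deg[OF that]
    show ?thesis by (auto simp: half_bounded_def)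
  qed
  then have R: "R $ (k - 1) = 0" by (simp add: R_def fps_sum_nth)
  have "W {} * inverse S = R - (\<Sum>A\<in>Pow {..<n} - {{}}. W A) * inverse S"
    using inverse_mult_eq_1'[OF S0] unfolding W0 by (simp add: algebra_simps flip: mult.assoc)
  with R rest have "(W {} * inverse S) $ (k - 1) = 0" by simp
  moreover have "X {} = (\<lambda>i. lo (u i))" by (auto simp: X_def)
  ultimately show ?thesis by (simp add: W_def S_def mult_ac)
qed

subsection \<open>The lower bound\<close>

text \<open>A generalized binomial coefficient vanishes only if some factor 1/2 - j does, which
  parity excludes. Every coefficient of the square root series can therefore be divided out.\<close>

lemma gchoose_half_nonzero: "(1 / 2 :: real) gchoose i \<noteq> 0"
proof -
  have "(1 / 2 :: real) \<noteq> real j" for j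
  proof
    assume "1 / 2 = real j"
    then have "real 1 = real (2 * j)" by simp
    then have "1 = 2 * j" unfolding of_nat_eq_iff .
    then show False by presburger
  qed
  then show ?thesis by (auto simp: gbinomial_prod_rev)
qed

text \<open>Each coefficient is a monomial in \<open>v\<close>, so a fixed coefficient of
  \<open>hi v * g\<close> is a polynomial in \<open>v\<close>.\<close>

lemma hi_nth: "hi v $ i = (if i = 0 then 1 else 1 / 2 * ((1 / 2) gchoose i) * 4 ^ i) * v ^ i"
  by (auto simp: hi_def fps_root_nth power_mult_distrib)

text \<open>The coefficient of degree \<open>k - 1\<close> in \<open>hi v * g\<close> is a
  polynomial in \<open>v\<close> of degree at most \<open>k - 1\<close>. It has the
  \<open>n + 1\<close> distinct zeros 0 and \<open>u i\<close>, more than its degree allows, so it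
  is zero and \<open>g\<close> has order at least \<open>k\<close>.\<close>

lemma lo_series_low_order:
  assumes P: "P \<in> polys n" and mult: "\<forall>a\<in>hypercube n - {origin}. zero_mult_at_least n k P a"
    and k: "k > 0" and n: "n > 0" "n \<ge> k - 1"
    and deg: "\<And>m. m \<in> Poly_Mapping.keys P \<Longrightarrow> monom_degree m < n + 2 * k - 3"
    and u: "inj_on u {..<n}" "\<And>i. i < n \<Longrightarrow> u i \<noteq> 0"
  shows "\<forall>d<k - 1. mpoly_feval (\<lambda>i. lo (u i)) P $ d = 0"
proof -
  define S where "S = (\<Prod>i<n. fps_root (u i))"
  define F where "F = mpoly_feval (\<lambda>i. lo (u i)) P"
  define g where "g = F * inverse S"
  define c where "c i = (if i = 0 then 1 else 1 / 2 * ((1 / 2 :: real) gchoose i) * 4 ^ i)" for i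
  have c: "c i \<noteq> 0" for i by (simp add: c_def gchoose_half_nonzero)
  have hi: "hi v $ i = c i * v ^ i" for v i by (simp add: c_def hi_nth)
  have unsign: "F $ d = 0" if "((- 1) ^ l * F) $ d = 0" for F :: "real fps" and l d
    using that by (cases "even l") auto
  \<comment> \<open>The difference of the e-th powers of the roots. It is 0 for
    \<open>e = 0\<close>, which allows the better parameter \<open>r = 1\<close>.\<close>
  have lucas_01: "1 * hi v ^ e + (- 1) * lo v ^ e = fps_root v * lucas 0 1 v e" for v e
    by (rule lucas_closed_form) (simp_all add: hi_minus_lo)
  \<comment> \<open>These weights put the extra factor \<open>hi v\<close> on the low root. The
    initial values are 1 and 0, so only \<open>r = 0\<close> is available.\<close>
  have lucas_10: "- lo v * hi v ^ e + hi v * lo v ^ e = fps_root v * lucas 1 0 v e" for v e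
    by (rule lucas_closed_form) (simp_all add: hi_minus_lo[symmetric] mult.commute)
  have bound_01: "half_bounded 1 e (lucas 0 1 v e)" for v e
    by (rule half_bounded_lucas) (auto simp: half_bounded_def)
  have bound_10: "half_bounded 0 e (lucas 1 0 v e)" for v e
    by (rule half_bounded_lucas) (auto simp: half_bounded_def)

  \<comment> \<open>With the signs 1 and -1 in every variable, degrees below
    \<open>n + 2 * k - 2\<close> are admissible. As \<open>hi 0 = 1\<close>, this gives the zero at
    \<open>v = 0\<close>.\<close>
  have "((\<Prod>i<n. - 1) * g) $ (k - 1) = 0"
    unfolding g_def F_def S_def
  proof (rule weighted_coeff_eq_0[OF P mult k, where \<alpha> = "\<lambda>_. 1" and Z = "\<lambda>i. lucas 0 1 (u i)" and r = "\<lambda>_. 1"])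
    show "monom_degree m < 2 * (k - 1) + (\<Sum>i<n. 1)" if "m \<in> Poly_Mapping.keys P" for m
      using deg[OF that] k n by simp
  qed (use lucas_01 bound_01 in auto)
  then have root0: "(hi 0 * g) $ (k - 1) = 0"
    using unsign[of n g "k - 1"] by (simp add: hi_def fps_root_def fps_compose_0_right flip: fps_const_1_eq_1)

  \<comment> \<open>Changing the weight of one variable lowers the sum of the \<open>r i\<close> to
    \<open>n - 1\<close>. The admissible degrees are now those below \<open>n + 2 * k - 3\<close>,
    exactly the hypothesis.\<close>
  have rootj: "(hi (u j) * g) $ (k - 1) = 0" if j: "j < n" for j
  proof -
    let ?\<beta> = "\<lambda>i. if i = j then hi (u i) else - 1"
    have "((\<Prod>i<n. ?\<beta> i) * g) $ (k - 1) = 0"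
      unfolding g_def F_def S_def
    proof (rule weighted_coeff_eq_0[OF P mult k, where \<alpha> = "\<lambda>i. if i = j then - lo (u i) else 1"
          and Z = "\<lambda>i. if i = j then lucas 1 0 (u i) else lucas 0 1 (u i)"
          and r = "\<lambda>i. if i = j then 0 else 1"])
      show "monom_degree m < 2 * (k - 1) + (\<Sum>i<n. if i = j then 0 else 1)"
        if "m \<in> Poly_Mapping.keys P" for m
        using deg[OF that] k n j by (simp add: sum.remove[of "{..<n}" j])
    qed (use lucas_01 lucas_10 bound_01 bound_10 in auto)
    also have "(\<Prod>i<n. ?\<beta> i) = hi (u j) * (- 1) ^ (n - 1)"
      using j by (simp add: prod.remove[of "{..<n}" j])
    finally show ?thesis
      using unsign[of "n - 1" "hi (u j) * g" "k - 1"] by (simp add: mult_ac)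
  qed

  define p where "p = (\<Sum>i\<le>k - 1. monom (c i * g $ (k - 1 - i)) i)"
  have poly_p: "poly p v = (hi v * g) $ (k - 1)" for v
    by (simp add: p_def poly_sum poly_monom fps_mult_nth hi atMost_atLeast0)
      (simp add: mult_ac)
  have "p = 0"
  proof (rule ccontr)
    assume "p \<noteq> 0"
    have "insert 0 (u ` {..<n}) \<subseteq> {x. poly p x = 0}"
      using root0 rootj by (auto simp: poly_p)
    then have "card (insert 0 (u ` {..<n})) \<le> card {x. poly p x = 0}"
      using poly_roots_finite[OF \<open>p \<noteq> 0\<close>] by (rule card_mono[rotated])
    also have "\<dots> \<le> degree p" by (rule card_poly_roots_bound) fact
    also have "degree p \<le> k - 1"
      unfolding p_def by (rule degree_sum_le) (auto intro: order.trans[OF degree_monom_le])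
    also have "card (insert 0 (u ` {..<n})) = Suc n"
      using u by (subst card_insert_disjoint) (auto simp: card_image)
    finally show False using n by simp
  qed
  have g: "g $ d = 0" if "d < k" for d
  proof -
    \<comment> \<open>The coefficients of \<open>p\<close> are those of \<open>g\<close> in reverse
      order, up to the nonzero factors \<open>c i\<close>.\<close>
    have "coeff p (k - 1 - d) = c (k - 1 - d) * g $ d"
      using that by (simp add: p_def coeff_sum)
    with \<open>p = 0\<close> c show ?thesis by simp
  qed
  have "S $ 0 = (\<Prod>i<n. fps_root (u i) $ 0)"
    unfolding S_def by (induction n) auto
  then have "S $ 0 \<noteq> 0" by (simp add: fps_root_nth)
  then have "F = g * S" by (simp add: g_def mult.assoc inverse_mult_eq_1)
  then show ?thesis
    using g by (auto simp: F_def[symmetric] intro!: fps_mult_nth_eq_0[of "k - 1"])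
qed

section \<open>Lowest-degree parts at the origin and generic points\<close>

lemma monom_degree_superset:
  assumes "finite S" "Poly_Mapping.keys m \<subseteq> S"
  shows "monom_degree m = (\<Sum>i\<in>S. Poly_Mapping.lookup m i)"
  unfolding monom_degree_def using assms
  by (intro sum.mono_neutral_left) (auto simp: in_keys_iff)

lemma monom_degree_add: "monom_degree (m + l) = monom_degree m + monom_degree l"
  by (simp add: monom_degree_superset[of "Poly_Mapping.keys m \<union> Poly_Mapping.keys l" m]
      monom_degree_superset[of "Poly_Mapping.keys m \<union> Poly_Mapping.keys l" l]
      monom_degree_superset[of "Poly_Mapping.keys m \<union> Poly_Mapping.keys l" "m + l"]
      Poly_Mapping.keys_add lookup_add sum.distrib)

lemma monom_degree_single: "monom_degree (Poly_Mapping.single i e) = e"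
  by (simp add: monom_degree_def)

lemma monom_split: "i \<in> Poly_Mapping.keys m \<Longrightarrow> (m - Poly_Mapping.single i 1) + Poly_Mapping.single i 1 = m"
  for m :: monomial
  by (intro poly_mapping_eqI) (auto simp: lookup_add lookup_minus lookup_single when_def in_keys_iff)

lemma mpoly_eval_origin: "mpoly_eval P origin = Poly_Mapping.lookup P 0"
proof -
  have "monom_eval origin m = (if m = 0 then 1 else 0)" for m
    by (auto simp: monom_eval_def origin_def zero_power_eq in_keys_iff prod_zero_iff poly_mapping_eq_iff fun_eq_iff)
  then show ?thesis
    by (simp add: mpoly_eval_def in_keys_iff if_distrib[of "\<lambda>x. _ * x"] cong: if_cong)
qed

text \<open>At the origin the value is the constant coefficient, and a partial derivative shifts
  coefficients down by one degree.\<close>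

lemma zero_mult_origin:
  assumes "\<And>m. monom_degree m < k \<Longrightarrow> Poly_Mapping.lookup P m = 0"
  shows "zero_mult_at_least n k P origin"
  using assms
proof (induction k arbitrary: P)
  case (Suc k)
  have "zero_mult_at_least n k (partial_deriv i P) origin" for i
    by (rule Suc.IH) (use Suc.prems in \<open>simp add: lookup_partial_deriv monom_degree_add monom_degree_single\<close>)
  with Suc.prems[of 0] show ?case by (simp add: zero_mult_Suc mpoly_eval_origin monom_degree_def)
qed (simp add: zero_mult_0)

text \<open>By uniqueness of derivatives, the formal partial derivatives of a polynomial that is
  zero as a function are again zero as functions. Up to a positive factor, a coefficient of
  \<open>P\<close> is one of a partial derivative at a monomial of smaller degree, down to the
  constant coefficient.\<close>

lemma mpoly_eq_0_if_eval_0: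
  assumes "\<And>a. mpoly_eval P a = 0"
  shows "P = 0"
proof (rule poly_mapping_eqI)
  have "Poly_Mapping.lookup P m = 0" for m
    using assms
  proof (induction "monom_degree m" arbitrary: m P rule: less_induct)
    case less
    show ?case
    proof (cases "Poly_Mapping.keys m = {}")
      case True
      with less.prems[of origin] show ?thesis by (simp add: mpoly_eval_origin)
    next
      case False
      then obtain i where i: "i \<in> Poly_Mapping.keys m" by blast
      let ?m' = "m - Poly_Mapping.single i 1"
      have "mpoly_eval (partial_deriv i P) a = 0" for a
        using partial_deriv_has_field_derivative[of P a i] less.prems
        by (auto dest: DERIV_unique[OF DERIV_const])
      moreover have "monom_degree ?m' < monom_degree m"
        using arg_cong[OF monom_split[OF i], of monom_degree]
        by (simp add: monom_degree_add monom_degree_single)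
      ultimately have "Poly_Mapping.lookup (partial_deriv i P) ?m' = 0"
        using less.hyps by blast
      then show ?thesis
        by (simp only: lookup_partial_deriv monom_split[OF i]) (simp add: of_nat_0_less_iff)
    qed
  qed
  then show "Poly_Mapping.lookup P m = Poly_Mapping.lookup 0 m" for m by simp
qed

text \<open>Moving \<open>v\<close> along a line with distinct nonzero slopes gives admissible
  points for all but finitely many parameters; continuity at parameter 0 gives the claim.\<close>

lemma mpoly_eval_0_if_generic_0:
  assumes "\<And>w. inj_on w {..<n} \<Longrightarrow> (\<And>i. i < n \<Longrightarrow> w i \<noteq> 0) \<Longrightarrow> mpoly_eval P w = 0"
  shows "mpoly_eval P v = 0"
proof -
  define w where "w \<epsilon> i = v i + \<epsilon> * (real i + 1)" for \<epsilon> :: real and i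
  \<comment> \<open>The parameters at which a coordinate vanishes or two coordinates coincide. Pairs
    with \<open>i = j\<close> contribute 0/0 = 0, which is harmless because the filter
    \<open>at 0\<close> leaves out 0.\<close>
  define B where "B = (\<lambda>i. - v i / (real i + 1)) ` {..<n} \<union>
    (\<lambda>(i, j). (v i - v j) / (real j - real i)) ` ({..<n} \<times> {..<n})"
  have "mpoly_eval P (w \<epsilon>) = 0" if "\<epsilon> \<notin> B" for \<epsilon>
  proof (rule assms)
    have "\<epsilon> = (v i - v j) / (real j - real i)" if "w \<epsilon> i = w \<epsilon> j" "i \<noteq> j" for i j
      using that by (simp add: w_def field_simps)
    with \<open>\<epsilon> \<notin> B\<close> show "inj_on (w \<epsilon>) {..<n}"
      unfolding inj_on_def B_def by fast
    show "w \<epsilon> i \<noteq> 0" if "i < n" for i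
    proof
      assume "w \<epsilon> i = 0"
      then have "\<epsilon> = - v i / (real i + 1)" by (simp add: w_def field_simps)
      with \<open>\<epsilon> \<notin> B\<close> that show False by (auto simp: B_def)
    qed
  qed
  moreover have "\<forall>\<^sub>F \<epsilon> in at 0. \<epsilon> \<notin> B"
  proof -
    have "open (- (B - {0}))"
      by (intro open_Compl finite_imp_closed) (simp add: B_def)
    then show ?thesis
      unfolding eventually_at_topological by (intro exI[of _ "- (B - {0})"]) auto
  qed
  ultimately have "\<forall>\<^sub>F \<epsilon> in at 0. mpoly_eval P (w \<epsilon>) = 0"
    by (auto elim: eventually_mono)
  then have "((\<lambda>\<epsilon>. mpoly_eval P (w \<epsilon>)) \<longlongrightarrow> 0) (at 0)"
    by (rule tendsto_eventually)
  moreover have "((\<lambda>\<epsilon>. mpoly_eval P (w \<epsilon>)) \<longlongrightarrow> mpoly_eval P (w 0)) (at 0)"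
    unfolding mpoly_eval_def monom_eval_def w_def by (intro tendsto_intros)
  ultimately have "mpoly_eval P (w 0) = 0" by (rule LIM_unique[symmetric])
  moreover have "w 0 = v" by (auto simp: w_def)
  ultimately show ?thesis by simp
qed

text \<open>Since \<open>lo u\<close> is -ut up to higher order, a monomial of degree e contributes
  t^e times its value at the negated \<open>u\<close>, up to higher order.\<close>

lemma lo_series_leading_coeff:
  assumes "\<And>m. m \<in> Poly_Mapping.keys P \<Longrightarrow> d \<le> monom_degree m"
  shows "mpoly_feval (\<lambda>i. lo (u i)) P $ d =
    (\<Sum>m\<in>Poly_Mapping.keys P. if monom_degree m = d then Poly_Mapping.lookup P m * monom_eval (\<lambda>i. - u i) m else 0)"
proof -
  define L where "L i = fps_shift 1 (lo (u i))" for i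
  have lo: "lo (u i) = fps_X * L i" for i
    by (rule fps_ext) (auto simp: L_def lo_nth_0 split: nat.split)
  have L0: "L i $ 0 = - u i" for i by (simp add: L_def lo_def fps_root_nth)
  have "monom_feval (\<lambda>i. lo (u i)) m = fps_X ^ monom_degree m * monom_feval L m" for m
    by (simp add: monom_feval_def monom_degree_def lo power_mult_distrib prod.distrib power_sum)
  moreover have "monom_feval L m $ 0 = monom_eval (\<lambda>i. - u i) m" for m
    using mpoly_feval_nth_0[of L "Poly_Mapping.single m 1"]
    by (simp add: mpoly_feval_single mpoly_eval_single L0)
  ultimately have "monom_feval (\<lambda>i. lo (u i)) m $ d = (if monom_degree m = d then monom_eval (\<lambda>i. - u i) m else 0)"
    if "d \<le> monom_degree m" for m
    using that by (auto simp: fps_X_power_mult_nth)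
  then show ?thesis
    using assms by (auto simp: mpoly_feval_def fps_sum_nth intro!: sum.cong)
qed

text \<open>Induction on the degree d < k - 1: once all lower parts vanish, the coefficient of t^d
  along the origin curve is the part of degree d evaluated at minus \<open>u\<close>. It is 0 for
  generic \<open>u\<close>, so that part is the zero polynomial.\<close>

lemma zero_mult_origin_if_low_degree:
  assumes P: "P \<in> polys n" and mult: "\<forall>a\<in>hypercube n - {origin}. zero_mult_at_least n k P a"
    and k: "k > 0" and n: "n > 0" "n \<ge> k - 1"
    and deg: "\<And>m. m \<in> Poly_Mapping.keys P \<Longrightarrow> monom_degree m < n + 2 * k - 3"
  shows "zero_mult_at_least n (k - 1) P origin"
proof (rule zero_mult_origin)
  have "\<forall>m. monom_degree m = d \<longrightarrow> Poly_Mapping.lookup P m = 0" if "d < k - 1" for d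
    using that
  proof (induction d rule: less_induct)
    case (less d)
    define H where "H = (\<Sum>m\<in>Poly_Mapping.keys P.
      Poly_Mapping.single m (if monom_degree m = d then Poly_Mapping.lookup P m else 0))"
    have low: "d \<le> monom_degree m" if "m \<in> Poly_Mapping.keys P" for m
      using less that by (auto simp: in_keys_iff not_less[symmetric])
    have "mpoly_eval H w = 0" if "inj_on w {..<n}" "\<And>i. i < n \<Longrightarrow> w i \<noteq> 0" for w
    proof -
      have "mpoly_eval H w = mpoly_feval (\<lambda>i. lo (- w i)) P $ d"
        by (subst lo_series_leading_coeff)
          (auto simp: low H_def mpoly_eval_sum mpoly_eval_single intro!: sum.cong)
      also have "\<dots> = 0"
        using that less.prems
        by (intro lo_series_low_order[OF P mult k n deg, rule_format]) (auto simp: inj_on_def)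
      finally show ?thesis .
    qed
    then have "H = 0"
      by (intro mpoly_eq_0_if_eval_0) (rule mpoly_eval_0_if_generic_0[of n], blast)
    moreover have "Poly_Mapping.lookup H m = Poly_Mapping.lookup P m" if "monom_degree m = d" for m
      using that by (auto simp: H_def lookup_sum lookup_single when_def in_keys_iff)
    ultimately show ?case by auto
  qed
  then show "Poly_Mapping.lookup P m = 0" if "monom_degree m < k - 1" for m using that by blast
qed

subsection \<open>Degree reduction and existence\<close>

definition mvar :: "nat \<Rightarrow> mpoly" where
  "mvar i = Poly_Mapping.single (Poly_Mapping.single i 1) 1"

lemma polysI: "(\<And>m. m \<in> Poly_Mapping.keys P \<Longrightarrow> Poly_Mapping.keys m \<subseteq> {..<n}) \<Longrightarrow> P \<in> polys n"
  by (auto simp: polys_def)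

lemma polys_add: "P \<in> polys n \<Longrightarrow> Q \<in> polys n \<Longrightarrow> P + Q \<in> polys n"
  using Poly_Mapping.keys_add[of P Q] by (auto simp: polys_def)

lemma polys_diff: "P \<in> polys n \<Longrightarrow> Q \<in> polys n \<Longrightarrow> P - Q \<in> polys n"
  using keys_diff[of P Q] by (auto simp: polys_def)

lemma polys_mult: "P \<in> polys n \<Longrightarrow> Q \<in> polys n \<Longrightarrow> P * Q \<in> polys n"
proof (rule polysI)
  fix m assume "P \<in> polys n" "Q \<in> polys n" "m \<in> Poly_Mapping.keys (P * Q)"
  then obtain a b where "m = a + b" "Poly_Mapping.keys a \<subseteq> {..<n}" "Poly_Mapping.keys b \<subseteq> {..<n}"
    using keys_mult[of P Q] by (auto simp: polys_def)
  then show "Poly_Mapping.keys m \<subseteq> {..<n}"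
    using Poly_Mapping.keys_add[of a b] by auto
qed

lemma polys_const: "Poly_Mapping.single 0 c \<in> polys n"
  by (auto simp: polys_def)

lemma polys_1: "1 \<in> polys n"
  using polys_const[of 1] by simp

lemma polys_mvar: "i < n \<Longrightarrow> mvar i \<in> polys n"
  by (auto simp: polys_def mvar_def)

lemma polys_power: "P \<in> polys n \<Longrightarrow> P ^ e \<in> polys n"
  by (induction e) (auto intro: polys_mult polys_1)

lemma polys_prod: "(\<And>i. i \<in> S \<Longrightarrow> P i \<in> polys n) \<Longrightarrow> prod P S \<in> polys n"
  by (induction S rule: infinite_finite_induct) (auto intro: polys_mult polys_1)

lemmas polys_intros = polys_add polys_diff polys_mult polys_const polys_1 polys_mvar polys_power polys_prod

section \<open>Degree bounds and leading parts\<close>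

text \<open>A strict bound avoids the convention that the zero polynomial has degree 0:
  \<open>deg_less 0\<close> holds for the zero polynomial alone.\<close>

definition deg_less :: "nat \<Rightarrow> mpoly \<Rightarrow> bool" where
  "deg_less d P \<longleftrightarrow> (\<forall>m\<in>Poly_Mapping.keys P. monom_degree m < d)"

lemma deg_less_add: "deg_less d P \<Longrightarrow> deg_less d Q \<Longrightarrow> deg_less d (P + Q)"
  using Poly_Mapping.keys_add[of P Q] by (auto simp: deg_less_def)

lemma deg_less_mult:
  assumes "deg_less d P" "deg_less (Suc e) Q"
  shows "deg_less (d + e) (P * Q)"
  unfolding deg_less_def
proof
  fix m assume "m \<in> Poly_Mapping.keys (P * Q)"
  then obtain a b where "m = a + b" "a \<in> Poly_Mapping.keys P" "b \<in> Poly_Mapping.keys Q"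
    using keys_mult[of P Q] by blast
  with assms show "monom_degree m < d + e"
    by (auto simp: deg_less_def monom_degree_add intro!: add_less_le_mono)
qed

lemma total_degree_le_iff: "total_degree P \<le> d \<longleftrightarrow> deg_less (Suc d) P"
  by (simp add: total_degree_def deg_less_def less_Suc_eq_le)

text \<open>Congruence modulo lower degree. It is compatible with products, so leading parts can be
  compared factor by factor.\<close>

definition same_lead :: "nat \<Rightarrow> mpoly \<Rightarrow> mpoly \<Rightarrow> bool" where
  "same_lead d P Q \<longleftrightarrow> deg_less (Suc d) P \<and> deg_less (Suc d) Q \<and> deg_less d (P - Q)"

lemma deg_less_1: "deg_less (Suc 0) 1"
  by (simp add: deg_less_def monom_degree_def)

lemma same_lead_1: "same_lead 0 1 1"
  by (simp add: same_lead_def deg_less_1) (simp add: deg_less_def)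

lemma same_lead_mult:
  assumes "same_lead d P P'" "same_lead e Q Q'"
  shows "same_lead (d + e) (P * Q) (P' * Q')"
proof -
  have "P * Q - P' * Q' = (P - P') * Q + (Q - Q') * P'"
    by (simp add: algebra_simps)
  moreover have "deg_less (d + e) ((P - P') * Q)" "deg_less (d + e) ((Q - Q') * P')"
    using assms deg_less_mult[of d "P - P'" e Q] deg_less_mult[of e "Q - Q'" d P']
    by (auto simp: same_lead_def add.commute)
  ultimately show ?thesis
    using assms deg_less_mult[of "Suc d" _ e] by (auto simp: same_lead_def intro: deg_less_add)
qed

lemma same_lead_power: "same_lead d P Q \<Longrightarrow> same_lead (e * d) (P ^ e) (Q ^ e)"
  by (induction e) (auto intro: same_lead_1 same_lead_mult)

lemma same_lead_prod:
  assumes "finite S" "\<And>i. i \<in> S \<Longrightarrow> same_lead (d i) (P i) (Q i)"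
  shows "same_lead (sum d S) (prod P S) (prod Q S)"
  using assms by (induction S) (auto intro: same_lead_1 same_lead_mult)

lemma same_lead_mvar: "same_lead 1 (mvar i) (mvar i)" "same_lead 1 (mvar i) (mvar i - 1)"
  using keys_diff[of "mvar i" 1]
  by (auto simp: same_lead_def deg_less_def mvar_def monom_degree_single monom_degree_def[of 0])

lemma mvar_power: "mvar i ^ e = Poly_Mapping.single (Poly_Mapping.single i e) 1"
  by (induction e) (auto simp: mvar_def mult_single simp flip: single_add)

lemma single_eq_prod_mvar:
  assumes "Poly_Mapping.keys m \<subseteq> {..<n}"
  shows "Poly_Mapping.single m 1 = (\<Prod>i<n. mvar i ^ Poly_Mapping.lookup m i)"
proof -
  have "(\<Prod>i\<in>S. mvar i ^ Poly_Mapping.lookup m i) =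
      Poly_Mapping.single (\<Sum>i\<in>S. Poly_Mapping.single i (Poly_Mapping.lookup m i)) 1" if "finite S" for S
    using that by (induction S) (auto simp: mvar_power mult_single)
  moreover have "(\<Sum>i<n. Poly_Mapping.single i (Poly_Mapping.lookup m i)) = m"
    using assms by (intro poly_mapping_eqI) (auto simp: lookup_sum lookup_single when_def in_keys_iff)
  ultimately show ?thesis by simp
qed

lemma zero_mult_power: "zero_mult_at_least n k P a \<Longrightarrow> zero_mult_at_least n (e * k) (P ^ e) a"
  by (induction e) (auto intro: zero_mult_0 zero_mult_mult)

lemma zero_mult_prod:
  "finite S \<Longrightarrow> (\<And>i. i \<in> S \<Longrightarrow> zero_mult_at_least n (k i) (P i) a) \<Longrightarrow>
     zero_mult_at_least n (sum k S) (prod P S) a"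
  by (induction S rule: finite_induct) (auto intro: zero_mult_0 zero_mult_mult)

lemma mpoly_eval_1: "mpoly_eval 1 a = 1"
  by (simp add: mpoly_eval_def monom_eval_def)

lemma mpoly_eval_mvar: "mpoly_eval (mvar i) a = a i"
  by (simp add: mvar_def mpoly_eval_single monom_eval_def)

lemma mpoly_eval_diff: "mpoly_eval (P - Q) a = mpoly_eval P a - mpoly_eval Q a"
  using mpoly_eval_add[of "P - Q" Q a] by simp

lemma zero_mult_1_iff: "zero_mult_at_least n 1 P a \<longleftrightarrow> mpoly_eval P a = 0"
  using zero_mult_Suc[of n 0] by (simp add: zero_mult_0)

text \<open>The larger half of an odd exponent goes to \<open>mvar i - 1\<close>, so that vertices
  other than the origin profit from it.\<close>

definition reducer :: "nat \<Rightarrow> monomial \<Rightarrow> mpoly" where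
  "reducer n m = (\<Prod>i<n. mvar i ^ (Poly_Mapping.lookup m i div 2) *
      (mvar i - 1) ^ (Poly_Mapping.lookup m i - Poly_Mapping.lookup m i div 2))"

lemma reducer_polys: "reducer n m \<in> polys n"
  unfolding reducer_def by (auto intro!: polys_intros)

text \<open>\<open>mvar i\<close> and \<open>mvar i - 1\<close> have the same leading part, so
  replacing one by the other changes only lower degrees.\<close>

lemma deg_less_reducer:
  assumes "Poly_Mapping.keys m \<subseteq> {..<n}"
  shows "deg_less (monom_degree m) (Poly_Mapping.single m 1 - reducer n m)"
proof -
  have "same_lead (e i) (mvar i ^ e i) (mvar i ^ (e i div 2) * (mvar i - 1) ^ (e i - e i div 2))" for e i
  proof -
    have "same_lead (e i div 2 * 1 + (e i - e i div 2) * 1) (mvar i ^ (e i div 2) * mvar i ^ (e i - e i div 2))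
       (mvar i ^ (e i div 2) * (mvar i - 1) ^ (e i - e i div 2))"
      by (intro same_lead_mult same_lead_power same_lead_mvar)
    moreover have "e i div 2 + (e i - e i div 2) = e i" by simp
    ultimately show ?thesis by (simp flip: power_add)
  qed
  then have "same_lead (\<Sum>i<n. Poly_Mapping.lookup m i) (\<Prod>i<n. mvar i ^ Poly_Mapping.lookup m i) (reducer n m)"
    unfolding reducer_def by (intro same_lead_prod) auto
  then show ?thesis
    using assms by (simp add: single_eq_prod_mvar monom_degree_superset[of "{..<n}"] same_lead_def)
qed

lemma zero_mult_zero: "zero_mult_at_least n k 0 a"
  by (induction k) (simp_all add: zero_mult_0 zero_mult_Suc partial_deriv_def)

text \<open>Adding elements of this ideal preserves multiplicity at least \<open>k\<close> away from
  the origin, as well as the exact multiplicity at the origin if that is below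
  \<open>k - 1\<close>.\<close>

definition vanishing :: "nat \<Rightarrow> nat \<Rightarrow> mpoly set" where
  "vanishing n k = {P. (\<forall>a\<in>hypercube n - {origin}. zero_mult_at_least n k P a) \<and>
     zero_mult_at_least n (k - 1) P origin}"

lemma vanishing_add: "P \<in> vanishing n k \<Longrightarrow> Q \<in> vanishing n k \<Longrightarrow> P + Q \<in> vanishing n k"
  by (auto simp: vanishing_def intro: zero_mult_add)

lemma zero_mult_mult_left: "zero_mult_at_least n k P a \<Longrightarrow> zero_mult_at_least n k (Q * P) a"
  using zero_mult_mult[of n 0 Q a k P] by (simp add: zero_mult_0)

lemma vanishing_mult: "P \<in> vanishing n k \<Longrightarrow> Q * P \<in> vanishing n k"
  by (auto simp: vanishing_def intro: zero_mult_mult_left)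

text \<open>Let F be the sum of the halves rounded down and O the number of odd exponents. Then 2F +
  O is at least n + 2k - 2 and O is at most n, so F is at least k - 1. The origin gets multiplicity
  F, and another vertex gets one more for each odd exponent at a coordinate 1.\<close>

lemma reducer_vanishing:
  assumes keys: "Poly_Mapping.keys m \<subseteq> {..<n}" and deg: "monom_degree m \<ge> n + 2 * k - 2" and "k > 0"
  shows "reducer n m \<in> vanishing n k"
proof -
  define e where "e i = Poly_Mapping.lookup m i" for i
  have deg_e: "(\<Sum>i<n. e i) \<ge> n + 2 * k - 2"
    using deg keys by (simp add: e_def monom_degree_superset[of "{..<n}"])
  have mult: "zero_mult_at_least n (\<Sum>i<n. if a i = 0 then e i div 2 else e i - e i div 2) (reducer n m) a"
    if a: "a \<in> hypercube n" for a
    unfolding reducer_def e_def[symmetric]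
  proof (rule zero_mult_prod)
    fix i assume "i \<in> {..<n}"
    with a have "a i = 0 \<or> a i = 1" by (auto simp: hypercube_def)
    then show "zero_mult_at_least n (if a i = 0 then e i div 2 else e i - e i div 2)
        (mvar i ^ (e i div 2) * (mvar i - 1) ^ (e i - e i div 2)) a"
    proof
      assume "a i = 0"
      then have "zero_mult_at_least n (e i div 2 * 1) (mvar i ^ (e i div 2)) a"
        by (intro zero_mult_power) (simp only: zero_mult_1_iff mpoly_eval_mvar)
      from zero_mult_mult[OF this zero_mult_0] \<open>a i = 0\<close> show ?thesis by simp
    next
      assume "a i = 1"
      then have "zero_mult_at_least n ((e i - e i div 2) * 1) ((mvar i - 1) ^ (e i - e i div 2)) a"
        by (intro zero_mult_power)
          (simp only: zero_mult_1_iff mpoly_eval_mvar mpoly_eval_diff mpoly_eval_1)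
      from zero_mult_mult[OF zero_mult_0 this] \<open>a i = 1\<close> show ?thesis by simp
    qed
  qed simp
  have floor_sum: "2 * (\<Sum>i<n. e i div 2) + (\<Sum>i<n. e i mod 2) = (\<Sum>i<n. e i)"
    by (simp add: sum_distrib_left flip: sum.distrib)
  have odd_le: "(\<Sum>i<n. e i mod 2) \<le> n"
    using sum_mono[of "{..<n}" "\<lambda>i. e i mod 2" "\<lambda>_. 1"] by fastforce
  have "zero_mult_at_least n (k - 1) (reducer n m) origin"
  proof (rule zero_mult_mono)
    show "zero_mult_at_least n (\<Sum>i<n. e i div 2) (reducer n m) origin"
      using mult[of origin] by (simp add: origin_def hypercube_def)
  qed (use floor_sum odd_le deg_e \<open>k > 0\<close> in linarith)
  moreover have "zero_mult_at_least n k (reducer n m) a" if a: "a \<in> hypercube n - {origin}" for a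
  proof (rule zero_mult_mono)
    show "zero_mult_at_least n (\<Sum>i<n. if a i = 0 then e i div 2 else e i - e i div 2) (reducer n m) a"
      using a by (intro mult) simp
    from a obtain j where j: "j < n" "a j \<noteq> 0"
      by (auto simp: hypercube_def origin_def fun_eq_iff) (metis not_le)
    have "x - x div 2 = x div 2 + x mod 2" for x :: nat by presburger
    then have split: "(if a i = 0 then e i div 2 else e i - e i div 2) =
        e i div 2 + (if a i = 0 then 0 else e i mod 2)" for i
      by simp
    show "k \<le> (\<Sum>i<n. if a i = 0 then e i div 2 else e i - e i div 2)"
    proof (cases "k \<le> (\<Sum>i<n. e i div 2)")
      case True
      then show ?thesis unfolding split sum.distrib by simp
    next
      \<comment> \<open>Now the bounds are tight: all exponents are odd, so the nonzero coordinate
        \<open>j\<close> supplies the missing order.\<close>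
      case False
      then have odd: "(\<Sum>i<n. e i mod 2) = n" and fl: "(\<Sum>i<n. e i div 2) \<ge> k - 1"
        using floor_sum odd_le deg_e \<open>k > 0\<close> by linarith+
      have "e j mod 2 = 1"
      proof (rule ccontr)
        assume "e j mod 2 \<noteq> 1"
        then have "(\<Sum>i<n. e i mod 2) < (\<Sum>i<n. 1)"
          using j by (intro sum_strict_mono_ex1) (auto intro!: bexI[of _ j])
        with odd show False by simp
      qed
      then have "1 \<le> (\<Sum>i<n. if a i = 0 then 0 else e i mod 2)"
        using j member_le_sum[of j "{..<n}" "\<lambda>i. if a i = 0 then 0 else e i mod 2"] by simp
      with fl show ?thesis unfolding split sum.distrib by linarith
    qed
  qed
  ultimately show ?thesis by (simp add: vanishing_def)
qed

text \<open>Modulo \<open>vanishing n k\<close>, a monomial of too large degree equals its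
  difference from its \<open>reducer\<close>, which has smaller degree. Strong induction on the
  degree bound treats the monomials one by one.\<close>

lemma low_degree_representative:
  assumes k: "k > 0" and P: "P \<in> polys n" "deg_less d P"
  obtains R where "R \<in> polys n" "deg_less (n + 2 * k - 2) R" "P - R \<in> vanishing n k"
proof -
  have zero: "0 \<in> vanishing n k"
    by (simp add: vanishing_def zero_mult_zero)
  have "\<exists>R\<in>polys n. deg_less (n + 2 * k - 2) R \<and> P - R \<in> vanishing n k"
    using P
  proof (induction d arbitrary: P rule: less_induct)
    case (less d)
    have mono: "\<exists>R\<in>polys n. deg_less (n + 2 * k - 2) R \<and> Poly_Mapping.single m c - R \<in> vanishing n k"
      if m: "m \<in> Poly_Mapping.keys P" for m c
    proof -
      have keys: "Poly_Mapping.keys m \<subseteq> {..<n}" and lt: "monom_degree m < d"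
        using less.prems m by (auto simp: polys_def deg_less_def)
      let ?c = "Poly_Mapping.single 0 c :: mpoly"
      have c: "Poly_Mapping.single m c = ?c * Poly_Mapping.single m 1" by (simp add: mult_single)
      have single: "Poly_Mapping.single m c \<in> polys n" using keys by (auto simp: polys_def)
      show ?thesis
      proof (cases "monom_degree m < n + 2 * k - 2")
        case True
        with single zero show ?thesis
          by (intro bexI[of _ "Poly_Mapping.single m c"]) (auto simp: deg_less_def)
      next
        case False
        let ?Q = "?c * (Poly_Mapping.single m 1 - reducer n m)"
        have "?Q \<in> polys n"
          using single reducer_polys[of n m] by (auto simp: right_diff_distrib c intro!: polys_intros)
        moreover have "deg_less (monom_degree m) ?Q"
          using deg_less_mult[OF deg_less_reducer[OF keys], of 0 ?c]
          by (auto simp: mult.commute deg_less_def monom_degree_def)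
        ultimately obtain R where R: "R \<in> polys n" "deg_less (n + 2 * k - 2) R" "?Q - R \<in> vanishing n k"
          using less.IH[OF lt] by blast
        have "Poly_Mapping.single m c - R = (?Q - R) + ?c * reducer n m"
          by (simp add: c algebra_simps)
        moreover have "(?Q - R) + ?c * reducer n m \<in> vanishing n k"
          using R(3) False k keys by (intro vanishing_add vanishing_mult reducer_vanishing) auto
        ultimately have "Poly_Mapping.single m c - R \<in> vanishing n k" by (simp only:)
        with R show ?thesis by blast
      qed
    qed
    have "\<exists>R\<in>polys n. deg_less (n + 2 * k - 2) R \<and> (\<Sum>m\<in>S. Poly_Mapping.single m (f m)) - R \<in> vanishing n k"
      if "finite S" "S \<subseteq> Poly_Mapping.keys P" for S f
      using that
    proof (induction S)
      case empty
      show ?case using zero polys_const[of 0 n] by (intro bexI[of _ 0]) (auto simp: deg_less_def)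
    next
      case (insert m S)
      then obtain R where R: "R \<in> polys n" "deg_less (n + 2 * k - 2) R"
          "(\<Sum>m\<in>S. Poly_Mapping.single m (f m)) - R \<in> vanishing n k" by auto
      obtain R' where R': "R' \<in> polys n" "deg_less (n + 2 * k - 2) R'"
          "Poly_Mapping.single m (f m) - R' \<in> vanishing n k"
        using mono[of m "f m"] insert.prems by auto
      have "(\<Sum>m\<in>insert m S. Poly_Mapping.single m (f m)) - (R' + R) =
         (Poly_Mapping.single m (f m) - R') + ((\<Sum>m\<in>S. Poly_Mapping.single m (f m)) - R)"
        using insert.hyps by simp
      with R R' show ?case
        by (intro bexI[of _ "R' + R"]) (simp_all only: vanishing_add deg_less_add polys_add)
    qed
    from this[of "Poly_Mapping.keys P" "Poly_Mapping.lookup P"] show ?case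
      using mpoly_eq_sum_single[of P] by simp
  qed
  then show ?thesis using that by blast
qed

lemma exists_exact_multiplicity:
  assumes "n > 0"
  obtains P where "P \<in> polys n" "\<forall>a\<in>hypercube n - {origin}. zero_mult_at_least n k P a"
    "zero_mult_exactly n l P origin"
proof
  define P where "P = (\<Prod>i<n. (mvar i - 1) ^ k) * mvar 0 ^ l"
  show "P \<in> polys n"
    unfolding P_def using assms by (auto intro!: polys_intros)
  show "\<forall>a\<in>hypercube n - {origin}. zero_mult_at_least n k P a"
  proof
    fix a assume a: "a \<in> hypercube n - {origin}"
    then obtain j where j: "j < n" "a j \<noteq> 0"
      by (auto simp: hypercube_def origin_def fun_eq_iff) (metis not_le)
    with a have "a j = 1" by (auto simp: hypercube_def)
    then have "zero_mult_at_least n (k * 1) ((mvar j - 1) ^ k) a"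
      by (intro zero_mult_power)
        (simp only: zero_mult_1_iff mpoly_eval_mvar mpoly_eval_diff mpoly_eval_1)
    moreover have "P = ((\<Prod>i\<in>{..<n} - {j}. (mvar i - 1) ^ k) * mvar 0 ^ l) * (mvar j - 1) ^ k"
      using j by (simp add: P_def prod.remove[of _ j] mult_ac)
    ultimately show "zero_mult_at_least n k P a" by (simp add: zero_mult_mult_left)
  qed
  have "zero_mult_at_least n (l * 1) (mvar 0 ^ l) origin"
    by (intro zero_mult_power) (simp only: zero_mult_1_iff mpoly_eval_mvar, simp add: origin_def)
  then have "zero_mult_at_least n l P origin"
    by (simp add: P_def zero_mult_mult_left)
  moreover have "\<not> zero_mult_at_least n (Suc l) P origin"
  proof
    assume *: "zero_mult_at_least n (Suc l) P origin"
    \<comment> \<open>Along the first axis, \<open>P\<close> becomes t^l times a series with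
      constant term 1 or -1, so its coefficient of t^l is nonzero.\<close>
    define X where "X i = (if i = 0 then fps_X else 0 :: real fps)" for i :: nat
    have X0: "(\<lambda>i. X i $ 0) = origin" by (auto simp: X_def origin_def)
    have "mpoly_feval X P $ l = 0"
      using zero_mult_feval[of n "Suc l" P X] * \<open>P \<in> polys n\<close> by (simp add: X0)
    moreover have "mpoly_feval X (mvar 0 ^ l) = fps_X ^ l"
      by (simp add: mvar_power mpoly_feval_single monom_feval_def X_def)
    ultimately have "mpoly_feval X (\<Prod>i<n. (mvar i - 1) ^ k) $ 0 = 0"
      by (simp add: P_def mpoly_feval_mult fps_X_power_mult_right_nth)
    moreover have "mpoly_eval (prod f S) a = (\<Prod>i\<in>S. mpoly_eval (f i) a)" for f :: "nat \<Rightarrow> mpoly" and S a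
      by (induction S rule: infinite_finite_induct) (auto simp: mpoly_eval_1 mpoly_eval_mult)
    moreover have "mpoly_eval (Q ^ e) a = mpoly_eval Q a ^ e" for Q e a
      by (induction e) (auto simp: mpoly_eval_1 mpoly_eval_mult)
    ultimately show False
      by (simp add: mpoly_feval_nth_0 X0 mpoly_eval_diff mpoly_eval_1 mpoly_eval_mvar)
        (simp add: origin_def)
  qed
  ultimately show "zero_mult_exactly n l P origin" by (simp add: zero_mult_exactly_def)
qed

theorem theorem1p4:
  fixes k n :: nat
  assumes "k \<ge> 2" and "n \<ge> 2 * k - 3"
  shows "(\<forall>P\<in>polys n.
            (\<forall>a\<in>hypercube n - {origin}. zero_mult_at_least n k P a) \<and>
            \<not> zero_mult_at_least n (k - 1) P origin
            \<longrightarrow> total_degree P \<ge> n + 2 * k - 3) \<and>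
         (\<forall>l\<in>{0..k - 2}. \<exists>P\<in>polys n.
            total_degree P = n + 2 * k - 3 \<and>
            (\<forall>a\<in>hypercube n - {origin}. zero_mult_at_least n k P a) \<and>
            zero_mult_exactly n l P origin)"
proof
  have k: "k > 0" and n: "n > 0" "n \<ge> k - 1" using assms by linarith+
  show lower: "\<forall>P\<in>polys n.
      (\<forall>a\<in>hypercube n - {origin}. zero_mult_at_least n k P a) \<and> \<not> zero_mult_at_least n (k - 1) P origin
      \<longrightarrow> total_degree P \<ge> n + 2 * k - 3"
  proof (intro ballI impI, elim conjE)
    fix P assume P: "P \<in> polys n" "\<forall>a\<in>hypercube n - {origin}. zero_mult_at_least n k P a"
      and nz: "\<not> zero_mult_at_least n (k - 1) P origin"
    show "total_degree P \<ge> n + 2 * k - 3"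
    proof (rule ccontr)
      assume "\<not> ?thesis"
      then have "monom_degree m < n + 2 * k - 3" if "m \<in> Poly_Mapping.keys P" for m
        using that total_degree_le_iff[of P "total_degree P"] by (fastforce simp: deg_less_def)
      with zero_mult_origin_if_low_degree[OF P k n] nz show False by blast
    qed
  qed
  show "\<forall>l\<in>{0..k - 2}. \<exists>P\<in>polys n. total_degree P = n + 2 * k - 3 \<and>
      (\<forall>a\<in>hypercube n - {origin}. zero_mult_at_least n k P a) \<and> zero_mult_exactly n l P origin"
  proof
    fix l assume l: "l \<in> {0..k - 2}"
    obtain P where P: "P \<in> polys n" "\<forall>a\<in>hypercube n - {origin}. zero_mult_at_least n k P a"
        "zero_mult_exactly n l P origin"
      using exists_exact_multiplicity[OF n(1)] by blast
    have "deg_less (Suc (total_degree P)) P" by (simp flip: total_degree_le_iff)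
    then obtain R where R: "R \<in> polys n" "deg_less (n + 2 * k - 2) R" "P - R \<in> vanishing n k"
      using low_degree_representative[OF k P(1)] by blast
    have neg: "zero_mult_at_least n j (- Q) a" if "zero_mult_at_least n j Q a" for j Q a
      using zero_mult_mult_left[OF that, of "- 1"] by simp
    have R_off: "\<forall>a\<in>hypercube n - {origin}. zero_mult_at_least n k R a"
    proof
      fix a assume a: "a \<in> hypercube n - {origin}"
      with P R have "zero_mult_at_least n k (P + - (P - R)) a"
        by (intro zero_mult_add neg) (auto simp: vanishing_def)
      then show "zero_mult_at_least n k R a" by simp
    qed
    have diff: "zero_mult_at_least n j (P - R) origin" if "j \<le> k - 1" for j
      using R(3) that by (auto simp: vanishing_def intro: zero_mult_mono)
    \<comment> \<open>Exact multiplicity \<open>l\<close> involves the thresholds \<open>l\<close>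
      and \<open>Suc l\<close>; both are at most \<open>k - 1\<close> because
      \<open>l \<le> k - 2\<close>.\<close>
    have "zero_mult_at_least n j R origin \<longleftrightarrow> zero_mult_at_least n j P origin" if "j \<le> k - 1" for j
      using zero_mult_add[OF _ diff[OF that], of R] zero_mult_add[OF _ neg[OF diff[OF that]], of P] by auto
    then have R_exact: "zero_mult_exactly n l R origin"
      using P(3) l assms(1) by (auto simp: zero_mult_exactly_def)
    moreover have "Suc l \<le> k - 1" using l assms(1) unfolding atLeastAtMost_iff by linarith
    ultimately have "\<not> zero_mult_at_least n (k - 1) R origin"
      using zero_mult_mono[of n "k - 1" R origin "Suc l"] by (auto simp: zero_mult_exactly_def)
    \<comment> \<open>The reduction bounds the degree only from above; equality comes from the lower
      bound, applied to \<open>R\<close> itself.\<close>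
    with lower R(1) R_off have "total_degree R \<ge> n + 2 * k - 3" by blast
    moreover have "total_degree R \<le> n + 2 * k - 3"
    proof -
      have "n + 2 * k - 2 = Suc (n + 2 * k - 3)" using k n by linarith
      with R(2) show ?thesis by (simp add: total_degree_le_iff)
    qed
    ultimately show "\<exists>P\<in>polys n. total_degree P = n + 2 * k - 3 \<and>
        (\<forall>a\<in>hypercube n - {origin}. zero_mult_at_least n k P a) \<and> zero_mult_exactly n l P origin"
      using R(1) R_off R_exact by (intro bexI[of _ R]) auto
  qed
qed

end
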